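(* Let $(I_{n})_{n\geq 2}$ be a sequence of functions $I_{n}:\Gamma^{\circ}_{n}\rightarrow\mathbb{R}$, and suppose that there exist a sequence $(\varepsilon_{n})_{n\geq 1}$ of nonnegative real numbers and a real number $\alpha\leq 0$ such that $$\left|I_{n}(p_{1}, \ldots, p_{n})-I_{n-1}(p_{1}+p_{2}, p_{3}, \ldots, p_{n})-(p_{1}+p_{2})^{\alpha}I_{2}\left(\frac{p_{1}}{p_{1}+p_{2}}, \frac{p_{2}}{p_{1}+p_{2}}\right)\right| \leq \varepsilon_{n-1}$$ for all $n\geq 3$ and $(p_{1}, \ldots, p_{n})\in\Gamma^{\circ}_{n}$, and $$\left|I_{3}(p_{1}, p_{2}, p_{3})-I_{3}(p_{1}, p_{3}, p_{2})\right|\leq \varepsilon_{1}$$ for all $(p_1,p_2,p_3)\in\Gamma^{\circ}_{3}$. Then: (i) in case $\alpha<0$, there exist $c, d\in\mathbb{R}$ such that $$\left|I_{n}(p_{1}, \ldots, p_{n})-\left(c H^{\alpha}_{n}(p_{1}, \ldots, p_{n})+d\left(p_{1}^{\alpha}-1\right)\right)\right| \leq \sum^{n-1}_{k=2}\varepsilon_{k}+15\left(2\varepsilon_{2}+\varepsilon_{1}\right)\left(1+\sum^{n-1}_{k=2}\left(\sum^{k}_{i=1}p_{i}\right)^{\alpha}\right)$$ for all $n\geq 2$ and $(p_{1}, \ldots, p_{n})\in\Gamma^{\circ}_{n}$; (ii) in case $\alpha=0$, there exist a logarithmic function $l:]0,1[\rightarrow\mathbb{R}$ and $c\in\mathbb{R}$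 such that $$\left|I_{n}(p_{1}, \ldots, p_{n})-\left(cH^{0}_{n}(p_{1}, \ldots, p_{n})+l(p_{1})\right)\right|\leq \sum^{n-1}_{k=2}\varepsilon_{k}+63(n-1)\left(2\varepsilon_{2}+\varepsilon_{1}\right)$$ for all $n\geq 2$ and $(p_{1}, \ldots, p_{n})\in\Gamma^{\circ}_{n}$. Here sums of the form $\sum_{k=2}^{1}$ are taken to be $0$.
   Context: For an integer $n\geq 2$, $$\Gamma^{\circ}_{n}=\left\{(p_{1}, \ldots, p_{n})\in\mathbb{R}^n : p_{i}>0 \ (i=1, \ldots, n),\ \sum^{n}_{i=1}p_{i}=1\right\}.$$ For $\alpha\leq 0$ and $n\ge 2$, the entropy of degree $\alpha$ is $$H^{\alpha}_{n}(p_{1}, \ldots, p_{n})=\left(2^{1-\alpha}-1\right)^{-1}\left(\sum^{n}_{i=1}p_{i}^{\alpha}-1\right),\qquad (p_{1}, \ldots, p_{n})\in\Gamma^{\circ}_{n}.$$ A function $l:]0,1[\rightarrow\mathbb{R}$ on the open unit interval is called logarithmic if $l(xy)=l(x)+l(y)$ for all $x,y\in ]0,1[$ (no regularity is assumed). *)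

theory Defs
  imports Complex_Main
begin

text \<open>
  A point \<open>(p\<^sub>1, \<dots>, p\<^sub>n)\<close> is the list \<open>[p\<^sub>1, \<dots>, p\<^sub>n]\<close>, so that the dimension can vary
  within a statement. In particular \<open>(p\<^sub>1 + p\<^sub>2, p\<^sub>3, \<dots>, p\<^sub>n)\<close> is \<open>(p1 + p2) # ps\<close> when the
  original point is \<open>p1 # p2 # ps\<close>.
\<close>

definition open_simplex :: "nat \<Rightarrow> real list set" where
  "open_simplex n = {ps. length ps = n \<and> (\<forall>p\<in>set ps. p > 0) \<and> sum_list ps = 1}"

text \<open>On \<open>open_simplex n\<close> this is \<open>H\<^sub>n\<close> of degree \<open>\<alpha>\<close>; the index \<open>n\<close> is the length of the list.\<close>

definition entropy_deg :: "real \<Rightarrow> real list \<Rightarrow> real" where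
  "entropy_deg \<alpha> ps = inverse (2 powr (1 - \<alpha>) - 1) * ((\<Sum>p\<leftarrow>ps. p powr \<alpha>) - 1)"

text \<open>Only the values of \<open>l\<close> on the open unit interval matter.\<close>

definition logarithmic :: "(real \<Rightarrow> real) \<Rightarrow> bool" where
  "logarithmic l \<longleftrightarrow> (\<forall>x\<in>{0<..<1}. \<forall>y\<in>{0<..<1}. l (x * y) = l x + l y)"

end

theory Submission
  imports Defs
begin

text \<open>
  Put \<open>F u v = (u + v)\<^sup>\<alpha> I\<^sub>2(u/(u+v), v/(u+v))\<close>, which is homogeneous of degree \<open>\<alpha>\<close>. The two
  hypotheses for \<open>n = 3\<close> say that \<open>F u v + F (u + v) w\<close> is symmetric in \<open>v, w\<close> up to
  \<open>e (u + v + w)\<^sup>\<alpha>\<close> with \<open>e = 2\<epsilon>\<^sub>2 + \<epsilon>\<^sub>1\<close>. It follows that the defect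
  \<open>T u v w = F u v + F (u + v) w - F u (v + w)\<close> depends on \<open>u\<close> only up to \<open>3e (u + z)\<^sup>\<alpha>\<close> when \<open>u\<close>
  is replaced by \<open>u + z\<close>.

  For \<open>\<alpha> < 0\<close>, letting \<open>z\<close> tend to infinity shows that \<open>T\<close> does not depend on \<open>u\<close> at all. Summing the \<open>2 \<times> 2\<close> matrix \<open>(1, s; r, rs)\<close> by rows and by columns then
  determines \<open>T\<close>, and what is left of \<open>F\<close> solves \<open>g (st) = g s + s\<^sup>\<alpha> g t\<close>, whose solutions are the
  multiples of \<open>1 - s\<^sup>\<alpha>\<close>. So \<open>I\<^sub>2\<close> has the asserted form without any error.

  For \<open>\<alpha> = 0\<close> the same matrix shows that \<open>T\<close> is constant up to \<open>16e\<close>, so that \<open>s \<mapsto> F 1 (s - 1)\<close>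
  minus that constant is logarithmic up to \<open>16e\<close>, and Hyers' theorem applies. In both cases the
  approximating functions are exactly recursive, and the errors add up along the recursion.
\<close>

section \<open>Stability of the additive Cauchy equation on the positive half-line\<close>

lemma Hyers_positive_reals:
  fixes G :: "real \<Rightarrow> real"
  assumes G: "\<And>x y. x > 0 \<Longrightarrow> y > 0 \<Longrightarrow> \<bar>G (x + y) - G x - G y\<bar> \<le> \<delta>"
  obtains A where "\<And>x y. x > 0 \<Longrightarrow> y > 0 \<Longrightarrow> A (x + y) = A x + A y"
    and "\<And>x. x > 0 \<Longrightarrow> \<bar>G x - A x\<bar> \<le> \<delta>"
proof -
  \<comment> \<open>Hyers' dyadic averages: doubling the argument moves \<open>s x\<close> by at
    most half of the remaining error, so the bounds form a geometric series with total exactly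
    \<open>\<delta>\<close>.\<close>
  define s where "s x n = G (2 ^ n * x) / 2 ^ n" for x n
  have step: "\<bar>s x (Suc n) - s x n\<bar> \<le> \<delta> * (1/2) ^ Suc n" if "x > 0" for x n
  proof -
    have "\<bar>G (2 ^ n * x + 2 ^ n * x) - G (2 ^ n * x) - G (2 ^ n * x)\<bar> \<le> \<delta>"
      using that by (intro G) auto
    moreover have "s x (Suc n) - s x n
        = (G (2 ^ n * x + 2 ^ n * x) - G (2 ^ n * x) - G (2 ^ n * x)) * (1/2) ^ Suc n"
      by (simp add: s_def field_simps)
    then have "\<bar>s x (Suc n) - s x n\<bar>
        = \<bar>G (2 ^ n * x + 2 ^ n * x) - G (2 ^ n * x) - G (2 ^ n * x)\<bar> * (1/2) ^ Suc n"
      by (simp only: abs_mult) simp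
    ultimately show ?thesis by (simp only: mult_right_mono zero_le_power zero_le_divide_1_iff zero_le_numeral)
  qed
  have geo: "(\<lambda>n. \<delta> * (1/2) ^ Suc n) sums \<delta>"
    using sums_mult[OF power_half_series, of \<delta>] by simp
  have summ: "summable (\<lambda>n. s x (Suc n) - s x n)" if "x > 0" for x
    using step[OF that] by (intro summable_comparison_test'[OF sums_summable[OF geo]]) simp
  define A where "A x = lim (s x)" for x
  have lim: "s x \<longlonglongrightarrow> A x" if "x > 0" for x
  proof -
    have "(\<lambda>n. s x n - s x 0) \<longlonglongrightarrow> (\<Sum>n. s x (Suc n) - s x n)"
      using summable_LIMSEQ[OF summ[OF that]] by (simp add: sum_lessThan_telescope)
    then have "(\<lambda>n. (s x n - s x 0) + s x 0) \<longlonglongrightarrow> (\<Sum>n. s x (Suc n) - s x n) + s x 0"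
      by (intro tendsto_intros)
    then show ?thesis unfolding A_def by (auto simp: convergent_LIMSEQ_iff[symmetric] convergent_def)
  qed
  show ?thesis
  proof
    fix x y :: real assume x: "x > 0" and y: "y > 0"
    have "(\<lambda>n. s (x + y) n - s x n - s y n) \<longlonglongrightarrow> A (x + y) - A x - A y"
      using x y by (intro tendsto_intros lim) auto
    moreover have "(\<lambda>n. s (x + y) n - s x n - s y n) \<longlonglongrightarrow> 0"
    proof (rule tendsto_0_le)
      have "\<bar>G (2 ^ n * x + 2 ^ n * y) - G (2 ^ n * x) - G (2 ^ n * y)\<bar> \<le> \<delta>" for n
        using x y by (intro G) auto
      then have "\<bar>G (2 ^ n * x + 2 ^ n * y) - G (2 ^ n * x) - G (2 ^ n * y)\<bar> \<le> \<bar>\<delta>\<bar>" for n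
        by (meson abs_ge_self order_trans)
      then show "\<forall>\<^sub>F n in sequentially. norm (s (x + y) n - s x n - s y n) \<le> norm (\<delta> * (1/2) ^ n) * 1"
        by (intro always_eventually allI)
          (simp add: s_def diff_divide_distrib[symmetric] distrib_left power_one_over abs_mult divide_right_mono)
      show "(\<lambda>n. \<delta> * (1/2) ^ n) \<longlonglongrightarrow> 0"
        by (rule tendsto_mult_right_zero, rule LIMSEQ_power_zero) simp
    qed
    ultimately show "A (x + y) = A x + A y" using LIMSEQ_unique by fastforce
  next
    fix x :: real assume x: "x > 0"
    have sG: "s x 0 = G x" by (simp add: s_def)
    \<comment> \<open>The induction carries the partial sum of the geometric series; the plain bound
      \<open>\<delta>\<close> would not reproduce itself.\<close>
    have "\<bar>s x n - G x\<bar> \<le> \<delta> - \<delta> * (1/2) ^ n" for n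
    proof (induction n)
      case (Suc n)
      define X where "X = \<delta> * (1/2) ^ n"
      have "\<bar>s x (Suc n) - s x n\<bar> \<le> X / 2" using step[OF x, of n] by (simp add: X_def)
      moreover have "\<bar>s x n - G x\<bar> \<le> \<delta> - X" using Suc by (simp add: X_def)
      moreover have "\<delta> * (1/2) ^ Suc n = X / 2" by (simp add: X_def)
      ultimately show ?case by linarith
    qed (simp add: sG)
    moreover have "\<delta> \<ge> 0" using G[of 1 1] by linarith
    then have "0 \<le> \<delta> * (1/2) ^ n" for n by simp
    ultimately have "\<bar>s x n - G x\<bar> \<le> \<delta>" for n by (meson diff_le_eq le_add_same_cancel1 order_trans)
    moreover have "(\<lambda>n. \<bar>s x n - G x\<bar>) \<longlonglongrightarrow> \<bar>A x - G x\<bar>"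
      by (intro tendsto_intros lim x)
    ultimately have "\<bar>A x - G x\<bar> \<le> \<delta>" by (intro LIMSEQ_le_const2) auto
    then show "\<bar>G x - A x\<bar> \<le> \<delta>" by linarith
  qed
qed

section \<open>Homogeneous functions whose two-step sums are almost symmetric\<close>

locale homogeneous_almost_symmetric =
  fixes F :: "real \<Rightarrow> real \<Rightarrow> real" and \<alpha> e :: real
  assumes homogeneous:
      "\<And>t u v. t > 0 \<Longrightarrow> u > 0 \<Longrightarrow> v > 0 \<Longrightarrow> F (t * u) (t * v) = t powr \<alpha> * F u v"
    and almost_symmetric:
      "\<And>u v w. u > 0 \<Longrightarrow> v > 0 \<Longrightarrow> w > 0 \<Longrightarrow>
         \<bar>F (u + v) w + F u v - F (u + w) v - F u w\<bar> \<le> e * (u + v + w) powr \<alpha>"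
    and nonpos: "\<alpha> \<le> 0"
begin

text \<open>Read \<open>F u v\<close> as the cost of moving from \<open>u\<close> to
  \<open>u + v\<close>. Then \<open>T\<close> measures how far the cost is from being additive when
  the step \<open>v + w\<close> is split, and \<open>almost_symmetric\<close> says that two steps
  may be swapped.\<close>

definition T :: "real \<Rightarrow> real \<Rightarrow> real \<Rightarrow> real" where
  "T u v w = F u v + F (u + v) w - F u (v + w)"

lemma e_nonneg: "e \<ge> 0"
proof -
  have "0 \<le> e * 3 powr \<alpha>" using almost_symmetric[of 1 1 1] by simp
  then show ?thesis by (simp add: zero_le_mult_iff)
qed

lemma powr_bound_mono:
  assumes "0 < x" "x \<le> y"
  shows "e * y powr \<alpha> \<le> e * x powr \<alpha>"
  using assms e_nonneg nonpos by (intro mult_left_mono powr_mono2') auto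

lemma T_homogeneous:
  assumes "t > 0" "u > 0" "v > 0" "w > 0"
  shows "T (t * u) (t * v) (t * w) = t powr \<alpha> * T u v w"
  using assms homogeneous[of t u v] homogeneous[of t "u + v" w] homogeneous[of t u "v + w"]
  by (simp add: T_def algebra_simps)

text \<open>Swapping steps shows that moving the base by \<open>z\<close> changes
  \<open>F u v\<close> by about \<open>F (u + v) z - F u z\<close>. These changes telescope to 0 in
  \<open>T\<close>. There are three swaps, and each total is at least \<open>u + z\<close>, where a
  power with \<alpha> \<le> 0 is largest.\<close>

lemma T_shift:
  assumes "u > 0" "v > 0" "w > 0" "z > 0"
  shows "\<bar>T (u + z) v w - T u v w\<bar> \<le> 3 * e * (u + z) powr \<alpha>"
proof -
  have 1: "\<bar>F (u + v) z + F u v - F (u + z) v - F u z\<bar> \<le> e * (u + z) powr \<alpha>"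
    using almost_symmetric[of u v z] powr_bound_mono[of "u + z" "u + v + z"] assms by linarith
  have 2: "\<bar>F (u + v + w) z + F (u + v) w - F (u + z + v) w - F (u + v) z\<bar>
      \<le> e * (u + z) powr \<alpha>"
    using almost_symmetric[of "u + v" w z] powr_bound_mono[of "u + z" "u + v + w + z"] assms
    by (simp add: add_ac; linarith)
  have 3: "\<bar>F (u + v + w) z + F u (v + w) - F (u + z) (v + w) - F u z\<bar> \<le> e * (u + z) powr \<alpha>"
    using almost_symmetric[of u "v + w" z] powr_bound_mono[of "u + z" "u + v + w + z"] assms
    by (simp add: add_ac; linarith)
  show ?thesis using 1 2 3 unfolding T_def by linarith
qed

text \<open>Each triple of defects telescopes to the cost of a four-step path minus the same direct
  cost \<open>F u ((1 + r) * (1 + s))\<close>. The paths take the steps 1, s, r, rs and 1, r, s, rs,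
  so a single swap at base \<open>u + 1\<close> relates them.\<close>

lemma T_matrix:
  assumes "u > 0" "r > 0" "s > 0"
  shows "\<bar>(T u 1 s + T u (1 + s) (r * (1 + s)) + T (u + 1 + s) r (r * s))
        - (T u 1 r + T u (1 + r) (s * (1 + r)) + T (u + 1 + r) s (r * s))\<bar> \<le> e * u powr \<alpha>"
proof -
  have "\<bar>F (u + 1 + s) r + F (u + 1) s - F (u + 1 + r) s - F (u + 1) r\<bar> \<le> e * u powr \<alpha>"
    using almost_symmetric[of "u + 1" s r] powr_bound_mono[of u "u + 1 + s + r"] assms by linarith
  moreover have "r * (1 + s) = r + r * s" "s * (1 + r) = s + r * s"
    by (simp_all add: algebra_simps)
  ultimately show ?thesis by (simp add: T_def add_ac; linarith)
qed

end

section \<open>Negative degree: the binary function is determined exactly\<close>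

locale negative_degree = homogeneous_almost_symmetric +
  assumes neg: "\<alpha> < 0"
begin

lemma bound_vanishes: "((\<lambda>z. c * (u + z) powr \<alpha>) \<longlongrightarrow> 0) at_top"
  by (intro tendsto_mult_right_zero tendsto_neg_powr neg filterlim_tendsto_add_at_top[OF tendsto_const filterlim_ident])

lemma T_shift_exact:
  assumes "u > 0" "v > 0" "w > 0" "z > 0"
  shows "T (u + z) v w = T u v w"
proof -
  \<comment> \<open>\<open>T\<close> at any base equals its limit along far bases, and
    \<open>u\<close> and \<open>u + z\<close> share their far bases.\<close>
  have lim: "((\<lambda>y. T (x + y) v w) \<longlongrightarrow> T x v w) at_top" if "x > 0" for x
  proof (rule LIM_zero_cancel, rule tendsto_0_le)
    show "\<forall>\<^sub>F y in at_top. norm (T (x + y) v w - T x v w) \<le> norm (3 * e * (x + y) powr \<alpha>) * 1"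
      using eventually_gt_at_top[of 0]
      by eventually_elim (use T_shift[OF that assms(2,3)] e_nonneg in simp)
  qed (rule bound_vanishes)
  have "filterlim (\<lambda>y. z + y) at_top at_top"
    by (intro filterlim_tendsto_add_at_top[OF tendsto_const filterlim_ident])
  from filterlim_compose[OF lim[OF assms(1)] this]
  have "((\<lambda>y. T (u + z + y) v w) \<longlongrightarrow> T u v w) at_top" by (simp add: add_ac)
  moreover have "((\<lambda>y. T (u + z + y) v w) \<longlongrightarrow> T (u + z) v w) at_top"
    using assms by (intro lim) auto
  ultimately show ?thesis by (metis tendsto_unique trivial_limit_at_top_linorder)
qed

lemma T_indep:
  assumes "u > 0" "u' > 0" "v > 0" "w > 0"
  shows "T u v w = T u' v w"
  using T_shift_exact[OF assms(1,3,4,2)] T_shift_exact[OF assms(2,3,4,1)] by (simp add: add_ac)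

lemma T_eq:
  obtains a where
    "\<And>u v w. u > 0 \<Longrightarrow> v > 0 \<Longrightarrow> w > 0 \<Longrightarrow> T u v w = a * (v powr \<alpha> + w powr \<alpha> - (v + w) powr \<alpha>)"
proof -
  define k where "k s = T 1 1 s" for s
  \<comment> \<open>\<open>q\<close> is the profile \<open>k\<close> would have if the claim held
    with \<open>a = 1\<close>, so the goal is that \<open>k\<close> is a multiple of
    \<open>q\<close>.\<close>
  define q where "q s = 1 + s powr \<alpha> - (1 + s) powr \<alpha>" for s :: real
  have T_k: "T u v w = v powr \<alpha> * k (w / v)" if "u > 0" "v > 0" "w > 0" for u v w
  proof -
    have "T u v w = T (v * 1) (v * 1) (v * (w / v))" using that T_indep[of u v v w] by simp
    then show ?thesis unfolding k_def using that by (subst (asm) T_homogeneous) auto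
  qed
  have comm: "k s * q r = k r * q s" if "r > 0" "s > 0" for r s
  proof -
    \<comment> \<open>By homogeneity and independence of the base, the matrix difference becomes
      \<open>E\<close>, which is free of \<open>u\<close>. Its bound tends to 0 as \<open>u\<close>
      grows, and \<open>E = 0\<close> is the proportionality
      \<open>k s * q r = k r * q s\<close>.\<close>
    define E where "E = (k s + (1 + s) powr \<alpha> * k r + r powr \<alpha> * k s)
        - (k r + (1 + r) powr \<alpha> * k s + s powr \<alpha> * k r)"
    have "\<bar>E\<bar> \<le> e * (0 + u) powr \<alpha>" if "u > 0" for u
      using T_matrix[of u r s] T_k[of u 1 s] T_k[of u "1 + s" "r * (1 + s)"] T_k[of "u + 1 + s" r "r * s"]
        T_k[of u 1 r] T_k[of u "1 + r" "s * (1 + r)"] T_k[of "u + 1 + r" s "r * s"]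
        that \<open>r > 0\<close> \<open>s > 0\<close> by (simp add: E_def)
    then have "\<forall>\<^sub>F u in at_top. \<bar>E\<bar> \<le> e * (0 + u) powr \<alpha>"
      by (intro eventually_mono[OF eventually_gt_at_top[of 0]])
    from tendsto_le[OF _ bound_vanishes tendsto_const this] have "E = 0" by simp
    then show ?thesis unfolding E_def q_def by (simp add: algebra_simps)
  qed
  have q1: "q 1 > 0"
  proof -
    have "2 powr \<alpha> < 2 powr 0" using neg by (intro powr_less_mono) auto
    then show ?thesis by (simp add: q_def)
  qed
  show ?thesis
  proof
    fix u v w :: real assume p: "u > 0" "v > 0" "w > 0"
    have "k (w / v) = k 1 / q 1 * q (w / v)"
      using comm[of 1 "w / v"] p q1 by (simp add: field_simps)
    moreover have "v powr \<alpha> * q (w / v) = v powr \<alpha> + w powr \<alpha> - (v + w) powr \<alpha>"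
    proof -
      have "v powr \<alpha> * (w / v) powr \<alpha> = w powr \<alpha>"
        "v powr \<alpha> * (1 + w / v) powr \<alpha> = (v + w) powr \<alpha>"
        using p by (simp_all flip: powr_mult add: distrib_left)
      then show ?thesis by (simp add: q_def algebra_simps)
    qed
    ultimately show "T u v w = k 1 / q 1 * (v powr \<alpha> + w powr \<alpha> - (v + w) powr \<alpha>)"
      using T_k[OF p] by (simp add: mult.left_commute)
  qed
qed

theorem F_eq:
  obtains a b where
    "\<And>u v. u > 0 \<Longrightarrow> v > 0 \<Longrightarrow> F u v = a * v powr \<alpha> + b * (u powr \<alpha> - (u + v) powr \<alpha>)"
proof -
  obtain a where a: "\<And>u v w. u > 0 \<Longrightarrow> v > 0 \<Longrightarrow> w > 0 \<Longrightarrow>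
      T u v w = a * (v powr \<alpha> + w powr \<alpha> - (v + w) powr \<alpha>)" using T_eq by blast
  \<comment> \<open>The summand \<open>a * v powr \<alpha>\<close> has precisely the defect
    \<open>T\<close>. What remains of \<open>F\<close> is additive along paths, and
    \<open>g s\<close> is its cost from 1 to \<open>s\<close>.\<close>
  define g where "g s = F 1 (s - 1) - a * (s - 1) powr \<alpha>" for s
  have F_g: "F u v = a * v powr \<alpha> + u powr \<alpha> * g (1 + v / u)" if "u > 0" "v > 0" for u v
  proof -
    have "F u v = u powr \<alpha> * F 1 (v / u)" using homogeneous[of u 1 "v / u"] that by simp
    moreover have "u powr \<alpha> * (v / u) powr \<alpha> = v powr \<alpha>"
      using that by (simp flip: powr_mult)
    ultimately show ?thesis by (simp add: g_def algebra_simps)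
  qed
  have g_mult: "g (s * t) = g s + s powr \<alpha> * g t" if "s > 1" "t > 1" for s t
  proof -
    have "T 1 (s - 1) (s * (t - 1))
        = a * ((s - 1) powr \<alpha> + (s * (t - 1)) powr \<alpha> - (s - 1 + s * (t - 1)) powr \<alpha>)"
      using that by (intro a) auto
    moreover have "F s (s * (t - 1)) = a * (s * (t - 1)) powr \<alpha> + s powr \<alpha> * g t"
      using that by (subst F_g) auto
    moreover have "s - 1 + s * (t - 1) = s * t - 1" by (simp add: algebra_simps)
    ultimately show ?thesis by (simp add: T_def g_def algebra_simps)
  qed
  have pow_less: "s powr \<alpha> < 1" if "s > 1" for s :: real
    using powr_less_mono2_neg[OF neg, of 1 s] that by simp
  define b where "b = g 2 / (1 - 2 powr \<alpha>)"
  have g: "g s = b * (1 - s powr \<alpha>)" if "s > 1" for s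
  proof -
    \<comment> \<open>Factoring \<open>2 * s\<close> in both orders expresses \<open>g s\<close>
      through \<open>g 2\<close>, which dictates the choice of \<open>b\<close>.\<close>
    have "g s + s powr \<alpha> * g 2 = g 2 + 2 powr \<alpha> * g s"
      using g_mult[of s 2] g_mult[of 2 s] that by (simp add: mult.commute)
    then have "g s * (1 - 2 powr \<alpha>) = g 2 * (1 - s powr \<alpha>)" by (simp add: algebra_simps)
    then show ?thesis using pow_less[of 2] neg by (simp add: b_def eq_divide_eq)
  qed
  show ?thesis
  proof
    fix u v :: real assume p: "u > 0" "v > 0"
    have "u powr \<alpha> * (1 + v / u) powr \<alpha> = (u + v) powr \<alpha>"
      using p by (simp flip: powr_mult add: distrib_left)
    then show "F u v = a * v powr \<alpha> + b * (u powr \<alpha> - (u + v) powr \<alpha>)"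
      using F_g[OF p] g[of "1 + v / u"] p by (simp add: algebra_simps)
  qed
qed

end

section \<open>Degree zero: the binary function is logarithmic up to a constant and a bounded
  error\<close>

locale degree_zero = homogeneous_almost_symmetric F 0 e for F e
begin

lemma T_near:
  assumes "u > 0" "u' > 0" "v > 0" "w > 0"
  shows "\<bar>T u v w - T u' v w\<bar> \<le> 3 * e"
proof (cases u u' rule: linorder_cases)
  case less
  then show ?thesis using T_shift[of u v w "u' - u"] assms by simp
next
  case greater
  then show ?thesis using T_shift[of u' v w "u - u'"] assms by simp
qed (use e_nonneg in simp)

lemma T_scale:
  assumes "u > 0" "v > 0" "w > 0"
  shows "\<bar>T u v w - T 1 1 (w / v)\<bar> \<le> 3 * e"
proof -
  have "T u v w = T (u / v) 1 (w / v)"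
    using T_homogeneous[of v "u / v" 1 "w / v"] assms by simp
  then show ?thesis using T_near[of "u / v" 1 1 "w / v"] assms by simp
qed

text \<open>For \<open>s = 1\<close> the matrix compares about \<open>2 * T 1 1 1 + T 1 1 r\<close>
  with \<open>T 1 1 1 + 2 * T 1 1 r\<close>, so \<open>T 1 1 r\<close> is close to
  \<open>T 1 1 1\<close>. Four replacements by \<open>T_scale\<close> cost \<open>12 * e\<close>,
  the matrix costs \<open>e\<close>, and passing from \<open>T u v w\<close> to
  \<open>T 1 1 r\<close> costs \<open>3 * e\<close>.\<close>

lemma T_almost_constant:
  assumes "u > 0" "v > 0" "w > 0"
  shows "\<bar>T u v w - T 1 1 1\<bar> \<le> 16 * e"
proof -
  define r where "r = w / v"
  have r: "r > 0" using assms by (simp add: r_def)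
  have "\<bar>T 1 2 (r * 2) - T 1 1 r\<bar> \<le> 3 * e" "\<bar>T 3 r r - T 1 1 1\<bar> \<le> 3 * e"
    "\<bar>T 1 (1 + r) (1 + r) - T 1 1 1\<bar> \<le> 3 * e" "\<bar>T (2 + r) 1 r - T 1 1 r\<bar> \<le> 3 * e"
    using T_scale[of 1 2 "r * 2"] T_scale[of 3 r r] T_scale[of 1 "1 + r" "1 + r"]
      T_scale[of "2 + r" 1 r] r by simp_all
  moreover have "\<bar>T u v w - T 1 1 r\<bar> \<le> 3 * e"
    using T_scale[OF assms] by (simp add: r_def)
  moreover have "\<bar>(T 1 1 1 + T 1 2 (r * 2) + T 3 r r)
      - (T 1 1 r + T 1 (1 + r) (1 + r) + T (2 + r) 1 r)\<bar> \<le> e"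
    using T_matrix[of 1 r 1] r by simp
  ultimately show ?thesis by linarith
qed

theorem F_near_logarithmic:
  "\<exists>a l. logarithmic l \<and> (\<forall>u>0. \<forall>v>0. \<bar>F u v - (a + l (u / (u + v)))\<bar> \<le> 16 * e)"
proof -
  define a where "a = T 1 1 1"
  \<comment> \<open>Writing endpoints as \<open>exp x\<close> turns scaling into translation, so the
    almost constant defect makes \<open>G\<close> almost additive. Conversely
    \<open>u / (u + v) = exp (- x)\<close> when \<open>1 + v / u = exp x\<close>, hence the choice
    of \<open>l\<close> below.\<close>
  define G where "G x = F 1 (exp x - 1) - a" for x
  have "\<bar>G (x + y) - G x - G y\<bar> \<le> 16 * e" if "x > 0" "y > 0" for x y
  proof -
    have "F (exp x) (exp x * (exp y - 1)) = F 1 (exp y - 1)"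
      using homogeneous[of "exp x" 1 "exp y - 1"] that by simp
    moreover have "\<bar>T 1 (exp x - 1) (exp x * (exp y - 1)) - a\<bar> \<le> 16 * e"
      unfolding a_def using that by (intro T_almost_constant) auto
    moreover have "exp x - 1 + exp x * (exp y - 1) = exp (x + y) - 1"
      by (simp add: exp_add algebra_simps)
    ultimately show ?thesis by (simp add: T_def G_def)
  qed
  then obtain A where A: "\<And>x y. x > 0 \<Longrightarrow> y > 0 \<Longrightarrow> A (x + y) = A x + A y"
    and GA: "\<And>x. x > 0 \<Longrightarrow> \<bar>G x - A x\<bar> \<le> 16 * e"
    using Hyers_positive_reals[of G "16 * e"] by metis
  show ?thesis
  proof (intro exI conjI allI impI)
    show "logarithmic (\<lambda>x. A (- ln x))"
      unfolding logarithmic_def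
    proof (intro ballI)
      fix x y :: real assume "x \<in> {0<..<1}" "y \<in> {0<..<1}"
      then show "A (- ln (x * y)) = A (- ln x) + A (- ln y)"
        using A[of "- ln x" "- ln y"] by (simp add: ln_mult)
    qed
  next
    fix u v :: real assume p: "u > 0" "v > 0"
    have "F u v = F 1 (v / u)" using homogeneous[of u 1 "v / u"] p by simp
    moreover have "exp (- ln (u / (u + v))) - 1 = v / u"
      using p by (simp add: exp_minus field_simps)
    moreover have "- ln (u / (u + v)) > 0" using p by simp
    ultimately show "\<bar>F u v - (a + A (- ln (u / (u + v))))\<bar> \<le> 16 * e"
      using GA[of "- ln (u / (u + v))"] by (simp add: G_def)
  qed
qed

end

section \<open>Propagation of errors along the recursion in the dimension\<close>

lemma open_simplex_merge:
  assumes "p1 # p2 # ps \<in> open_simplex (Suc n)"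
  shows "(p1 + p2) # ps \<in> open_simplex n"
  using assms by (auto simp: open_simplex_def)

lemma sum_nth_merge:
  fixes p1 p2 :: real
  assumes "k \<ge> 1"
  shows "(\<Sum>i<Suc k. (p1 # p2 # ps) ! i) = (\<Sum>i<k. ((p1 + p2) # ps) ! i)"
proof -
  obtain j where "k = Suc j" using assms by (cases k) auto
  then show ?thesis by (simp only: sum.lessThan_Suc_shift) simp
qed

text \<open>Subtracting the exact recursion for \<open>G\<close> from the approximate one for
  \<open>I\<close>, each merge of the first two entries adds one \<epsilon> and the binary error
  \<open>K\<close> weighted by \<open>(p1 + p2) powr \<alpha>\<close>.\<close>

lemma recursive_approximation:
  fixes I :: "nat \<Rightarrow> real list \<Rightarrow> real" and G :: "real list \<Rightarrow> real"
  assumes I: "\<And>n p1 p2 ps. n \<ge> 3 \<Longrightarrow> p1 # p2 # ps \<in> open_simplex n \<Longrightarrow>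
      \<bar>I n (p1 # p2 # ps) - I (n - 1) ((p1 + p2) # ps)
         - (p1 + p2) powr \<alpha> * I 2 [p1 / (p1 + p2), p2 / (p1 + p2)]\<bar> \<le> \<epsilon> (n - 1)"
    and G: "\<And>n p1 p2 ps. n \<ge> 3 \<Longrightarrow> p1 # p2 # ps \<in> open_simplex n \<Longrightarrow>
      G (p1 # p2 # ps) = G ((p1 + p2) # ps)
         + (p1 + p2) powr \<alpha> * G [p1 / (p1 + p2), p2 / (p1 + p2)]"
    and base: "\<And>p1 p2. [p1, p2] \<in> open_simplex 2 \<Longrightarrow> \<bar>I 2 [p1, p2] - G [p1, p2]\<bar> \<le> K"
    and "n \<ge> 2" "ps \<in> open_simplex n"
  shows "\<bar>I n ps - G ps\<bar>
    \<le> (\<Sum>k=2..n-1. \<epsilon> k) + K * (1 + (\<Sum>k=2..n-1. (\<Sum>i<k. ps ! i) powr \<alpha>))"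
  using \<open>n \<ge> 2\<close> \<open>ps \<in> open_simplex n\<close>
proof (induction n arbitrary: ps rule: dec_induct)
  case base
  then obtain p1 p2 where "ps = [p1, p2]"
    by (auto simp: open_simplex_def numeral_2_eq_2 length_Suc_conv)
  then show ?case using assms(3)[of p1 p2] base by simp
next
  case (step n)
  then obtain p1 p2 qs where ps: "ps = p1 # p2 # qs"
    by (cases n) (auto simp: open_simplex_def length_Suc_conv)
  have p: "p1 > 0" "p2 > 0" using step.prems by (auto simp: ps open_simplex_def)
  define s where "s k = (\<Sum>i<k. ps ! i) powr \<alpha>" for k
  define s' where "s' k = (\<Sum>i<k. ((p1 + p2) # qs) ! i) powr \<alpha>" for k
  \<comment> \<open>The merged list has the same partial sums with the index lowered by one, so only
    the term \<open>k = 2\<close> is new.\<close>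
  have "(\<Sum>k=2..n. s k) = s 2 + (\<Sum>k=Suc 2..n. s k)"
    using step.hyps by (simp add: sum.atLeast_Suc_atMost)
  also have "(\<Sum>k=Suc 2..n. s k) = (\<Sum>k=2..n-1. s (Suc k))"
    using step.hyps sum.shift_bounds_cl_Suc_ivl[of s 2 "n - 1"] by simp
  also have "\<dots> = (\<Sum>k=2..n-1. s' k)"
    by (intro sum.cong refl) (simp only: s_def s'_def ps, subst sum_nth_merge, auto)
  also have "s 2 = (p1 + p2) powr \<alpha>" by (simp add: s_def ps numeral_2_eq_2)
  finally have s: "(\<Sum>k=2..n. s k) = (p1 + p2) powr \<alpha> + (\<Sum>k=2..n-1. s' k)" .
  have \<epsilon>: "(\<Sum>k=2..n. \<epsilon> k) = (\<Sum>k=2..n-1. \<epsilon> k) + \<epsilon> n"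
    using step.hyps by (cases n) auto
  have IH: "\<bar>I n ((p1 + p2) # qs) - G ((p1 + p2) # qs)\<bar>
      \<le> (\<Sum>k=2..n-1. \<epsilon> k) + K * (1 + (\<Sum>k=2..n-1. s' k))"
    unfolding s'_def using step.prems ps by (intro step.IH open_simplex_merge) auto
  have "[p1 / (p1 + p2), p2 / (p1 + p2)] \<in> open_simplex 2"
    using p by (auto simp: open_simplex_def add_divide_distrib[symmetric])
  from assms(3)[OF this] have
    "(p1 + p2) powr \<alpha> * \<bar>I 2 [p1 / (p1 + p2), p2 / (p1 + p2)] - G [p1 / (p1 + p2), p2 / (p1 + p2)]\<bar>
      \<le> (p1 + p2) powr \<alpha> * K" by (intro mult_left_mono) auto
  then have "\<bar>(p1 + p2) powr \<alpha> * I 2 [p1 / (p1 + p2), p2 / (p1 + p2)]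
      - (p1 + p2) powr \<alpha> * G [p1 / (p1 + p2), p2 / (p1 + p2)]\<bar> \<le> K * (p1 + p2) powr \<alpha>"
    by (simp add: right_diff_distrib[symmetric] abs_mult mult.commute)
  moreover have "\<bar>I (Suc n) ps - I n ((p1 + p2) # qs)
      - (p1 + p2) powr \<alpha> * I 2 [p1 / (p1 + p2), p2 / (p1 + p2)]\<bar> \<le> \<epsilon> n"
    using I[of "Suc n" p1 p2 qs] step.hyps step.prems ps by simp
  moreover have "G ps = G ((p1 + p2) # qs)
      + (p1 + p2) powr \<alpha> * G [p1 / (p1 + p2), p2 / (p1 + p2)]"
    using G[of "Suc n" p1 p2 qs] step.hyps step.prems ps by simp
  moreover have "K * (1 + (\<Sum>k=2..n. s k))
      = K * (1 + (\<Sum>k=2..n-1. s' k)) + K * (p1 + p2) powr \<alpha>"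
    by (simp add: s algebra_simps)
  ultimately show ?case using IH \<epsilon> by (simp add: s_def) linarith
qed

lemma entropy_deg_recursive:
  assumes "p1 > 0" "p2 > 0"
  shows "entropy_deg \<alpha> (p1 # p2 # ps) = entropy_deg \<alpha> ((p1 + p2) # ps)
    + (p1 + p2) powr \<alpha> * entropy_deg \<alpha> [p1 / (p1 + p2), p2 / (p1 + p2)]"
proof -
  have "(p1 + p2) powr \<alpha> * (p1 / (p1 + p2)) powr \<alpha> = p1 powr \<alpha>"
    "(p1 + p2) powr \<alpha> * (p2 / (p1 + p2)) powr \<alpha> = p2 powr \<alpha>"
    using assms by (simp_all flip: powr_mult)
  then have "(p1 + p2) powr \<alpha> * ((p1 / (p1 + p2)) powr \<alpha> + (p2 / (p1 + p2)) powr \<alpha> - 1)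
      = p1 powr \<alpha> + p2 powr \<alpha> - (p1 + p2) powr \<alpha>"
    by (simp only: right_diff_distrib distrib_left mult_1_right)
  then show ?thesis
    unfolding entropy_deg_def by (subst mult.left_commute) (simp add: add_diff_eq flip: distrib_left)
qed

section \<open>Passage from the sequence to its binary function, and the two cases\<close>

theorem theorem3p2:
  fixes I :: "nat \<Rightarrow> real list \<Rightarrow> real"
    and \<epsilon> :: "nat \<Rightarrow> real"
    and \<alpha> :: real
  assumes eps_nonneg: "\<And>n. n \<ge> 1 \<Longrightarrow> \<epsilon> n \<ge> 0"
    and alpha_nonpos: "\<alpha> \<le> 0"
    and approx_recursive:
      "\<And>n p1 p2 ps. n \<ge> 3 \<Longrightarrow> p1 # p2 # ps \<in> open_simplex n \<Longrightarrow>
         \<bar>I n (p1 # p2 # ps) - I (n - 1) ((p1 + p2) # ps)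
            - (p1 + p2) powr \<alpha> * I 2 [p1 / (p1 + p2), p2 / (p1 + p2)]\<bar> \<le> \<epsilon> (n - 1)"
    and approx_symmetric:
      "\<And>p1 p2 p3. [p1, p2, p3] \<in> open_simplex 3 \<Longrightarrow>
         \<bar>I 3 [p1, p2, p3] - I 3 [p1, p3, p2]\<bar> \<le> \<epsilon> 1"
  shows "(\<alpha> < 0 \<longrightarrow>
            (\<exists>c d :: real. \<forall>n\<ge>2. \<forall>ps\<in>open_simplex n.
               \<bar>I n ps - (c * entropy_deg \<alpha> ps + d * ((ps ! 0) powr \<alpha> - 1))\<bar>
                 \<le> (\<Sum>k=2..n-1. \<epsilon> k)
                    + 15 * (2 * \<epsilon> 2 + \<epsilon> 1)
                      * (1 + (\<Sum>k=2..n-1. (\<Sum>i<k. ps ! i) powr \<alpha>))))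
       \<and> (\<alpha> = 0 \<longrightarrow>
            (\<exists>(l :: real \<Rightarrow> real) (c :: real). logarithmic l \<and>
               (\<forall>n\<ge>2. \<forall>ps\<in>open_simplex n.
                  \<bar>I n ps - (c * entropy_deg 0 ps + l (ps ! 0))\<bar>
                    \<le> (\<Sum>k=2..n-1. \<epsilon> k)
                       + 63 * real (n - 1) * (2 * \<epsilon> 2 + \<epsilon> 1))))"
proof -
  define e where "e = 2 * \<epsilon> 2 + \<epsilon> 1"
  have e0: "e \<ge> 0" using eps_nonneg[of 1] eps_nonneg[of 2] by (simp add: e_def)
  \<comment> \<open>The homogeneous extension of \<open>I 2\<close> to the open quadrant; the last
    term of the recursion is then \<open>F p1 p2\<close>.\<close>
  define F where "F u v = (u + v) powr \<alpha> * I 2 [u / (u + v), v / (u + v)]" for u v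
  have F_I: "F p1 p2 = I 2 [p1, p2]" if "[p1, p2] \<in> open_simplex 2" for p1 p2
    using that by (simp add: F_def open_simplex_def)
  have F_hom: "F (t * u) (t * v) = t powr \<alpha> * F u v" if "t > 0" "u > 0" "v > 0" for t u v
  proof -
    have "(t * u + t * v) powr \<alpha> = t powr \<alpha> * (u + v) powr \<alpha>"
      using that by (simp flip: powr_mult add: distrib_left)
    then show ?thesis using that by (simp add: F_def flip: distrib_left)
  qed
  \<comment> \<open>The recursion expands both orders of \<open>I 3\<close> at the cost of
    \<open>\<epsilon> 2\<close> each, and the symmetry adds \<open>\<epsilon> 1\<close>; this is
    where \<open>e\<close> comes from.\<close>
  have F_sym1: "\<bar>F (u + v) w + F u v - F (u + w) v - F u w\<bar> \<le> e"
    if "u > 0" "v > 0" "w > 0" "u + v + w = 1" for u v w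
  proof -
    have "[u, v, w] \<in> open_simplex 3" "[u, w, v] \<in> open_simplex 3"
      using that by (auto simp: open_simplex_def)
    note S = this
    have "[u + v, w] \<in> open_simplex 2" "[u + w, v] \<in> open_simplex 2"
      using that by (auto simp: open_simplex_def)
    then have "\<bar>I 3 [u, v, w] - F (u + v) w - F u v\<bar> \<le> \<epsilon> 2"
      "\<bar>I 3 [u, w, v] - F (u + w) v - F u w\<bar> \<le> \<epsilon> 2"
      using approx_recursive[OF _ S(1)] approx_recursive[OF _ S(2)]
      by (simp_all add: F_I F_def[of u v] F_def[of u w])
    then show ?thesis using approx_symmetric[OF S(1)] unfolding e_def by linarith
  qed
  have F_sym: "\<bar>F (u + v) w + F u v - F (u + w) v - F u w\<bar> \<le> e * (u + v + w) powr \<alpha>"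
    if "u > 0" "v > 0" "w > 0" for u v w
  proof -
    define t where "t = u + v + w"
    have t: "t > 0" using that by (simp add: t_def)
    have hom: "F x y = t powr \<alpha> * F (x / t) (y / t)" if "x > 0" "y > 0" for x y
      using F_hom[of t "x / t" "y / t"] t that by simp
    have "F (u + v) w + F u v - F (u + w) v - F u w = t powr \<alpha> *
       (F (u / t + v / t) (w / t) + F (u / t) (v / t) - F (u / t + w / t) (v / t) - F (u / t) (w / t))"
      using that by (simp add: hom[of "u + v" w] hom[of u v] hom[of "u + w" v] hom[of u w]
          add_divide_distrib algebra_simps)
    then have "\<bar>F (u + v) w + F u v - F (u + w) v - F u w\<bar> = t powr \<alpha> *
       \<bar>F (u / t + v / t) (w / t) + F (u / t) (v / t) - F (u / t + w / t) (v / t) - F (u / t) (w / t)\<bar>"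
      by (simp only: abs_mult) simp
    also have "\<dots> \<le> t powr \<alpha> * e"
      using that t by (intro mult_left_mono F_sym1) (auto simp: t_def add_divide_distrib[symmetric])
    finally show ?thesis by (simp add: t_def mult.commute)
  qed
  have H: "homogeneous_almost_symmetric F \<alpha> e"
    by unfold_locales (use F_hom F_sym alpha_nonpos in auto)
  show ?thesis
  proof (intro conjI impI)
    assume neg: "\<alpha> < 0"
    interpret negative_degree F \<alpha> e by (intro negative_degree.intro negative_degree_axioms.intro H neg)
    obtain a b where ab: "\<And>u v. u > 0 \<Longrightarrow> v > 0 \<Longrightarrow>
        F u v = a * v powr \<alpha> + b * (u powr \<alpha> - (u + v) powr \<alpha>)" using F_eq by blast
    \<comment> \<open>The factor cancels the normalisation of the entropy. For
      \<open>p1 + p2 = 1\<close>, \<open>F p1 p2\<close> is \<open>a * (p1 powr \<alpha> + p2 powr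
      \<alpha> - 1) + (b - a) * (p1 powr \<alpha> - 1)\<close>, hence
      \<open>d = b - a\<close>.\<close>
    define c where "c = a * (2 powr (1 - \<alpha>) - 1)"
    define G where "G ps = c * entropy_deg \<alpha> ps + (b - a) * ((ps ! 0) powr \<alpha> - 1)" for ps
    have "2 powr (1 - \<alpha>) > (2::real) powr 0" using neg by (intro powr_less_mono) auto
    then have c: "c * inverse (2 powr (1 - \<alpha>) - 1) = a" using neg by (simp add: c_def divide_inverse[symmetric])
    have bound: "\<bar>I n ps - G ps\<bar>
        \<le> (\<Sum>k=2..n-1. \<epsilon> k) + 15 * e * (1 + (\<Sum>k=2..n-1. (\<Sum>i<k. ps ! i) powr \<alpha>))"
      if "n \<ge> 2" "ps \<in> open_simplex n" for n ps
    proof (rule recursive_approximation[OF approx_recursive _ _ that])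
      fix n p1 p2 ps assume "p1 # p2 # ps \<in> open_simplex n"
      then have p: "p1 > 0" "p2 > 0" by (auto simp: open_simplex_def)
      have "(p1 + p2) powr \<alpha> * (p1 / (p1 + p2)) powr \<alpha> = p1 powr \<alpha>"
        using p by (simp flip: powr_mult)
      then show "G (p1 # p2 # ps) = G ((p1 + p2) # ps)
          + (p1 + p2) powr \<alpha> * G [p1 / (p1 + p2), p2 / (p1 + p2)]"
        unfolding G_def entropy_deg_recursive[OF p] nth_Cons_0 by (simp only: algebra_simps)
    next
      fix p1 p2 :: real assume S: "[p1, p2] \<in> open_simplex 2"
      then have p: "p1 > 0" "p2 > 0" "p1 + p2 = 1" by (auto simp: open_simplex_def)
      have "G [p1, p2] = (c * inverse (2 powr (1 - \<alpha>) - 1)) * (p1 powr \<alpha> + p2 powr \<alpha> - 1)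
          + (b - a) * (p1 powr \<alpha> - 1)"
        by (simp add: G_def entropy_deg_def add_diff_eq)
      moreover have "I 2 [p1, p2] = a * p2 powr \<alpha> + b * (p1 powr \<alpha> - 1)"
        using ab[OF p(1,2)] F_I[OF S] p(3) by simp
      ultimately have "I 2 [p1, p2] = G [p1, p2]" unfolding c by (simp add: algebra_simps)
      then show "\<bar>I 2 [p1, p2] - G [p1, p2]\<bar> \<le> 15 * e" using e0 by simp
    qed
    show "\<exists>c d :: real. \<forall>n\<ge>2. \<forall>ps\<in>open_simplex n.
               \<bar>I n ps - (c * entropy_deg \<alpha> ps + d * ((ps ! 0) powr \<alpha> - 1))\<bar>
                 \<le> (\<Sum>k=2..n-1. \<epsilon> k)
                    + 15 * (2 * \<epsilon> 2 + \<epsilon> 1)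
                      * (1 + (\<Sum>k=2..n-1. (\<Sum>i<k. ps ! i) powr \<alpha>))"
      by (intro exI[of _ c] exI[of _ "b - a"] allI impI ballI bound[unfolded G_def e_def])
  next
    assume \<alpha>: "\<alpha> = 0"
    interpret degree_zero F e
      using H by (simp add: degree_zero_def \<alpha>)
    obtain a l where l: "logarithmic l"
      and al: "\<And>u v. u > 0 \<Longrightarrow> v > 0 \<Longrightarrow> \<bar>F u v - (a + l (u / (u + v)))\<bar> \<le> 16 * e"
      using F_near_logarithmic by blast
    define G where "G ps = a * entropy_deg 0 ps + l (ps ! 0)" for ps
    have bound: "\<bar>I n ps - G ps\<bar> \<le> (\<Sum>k=2..n-1. \<epsilon> k) + 63 * real (n - 1) * e"
      if n: "n \<ge> 2" and ps: "ps \<in> open_simplex n" for n ps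
    proof -
      have "\<bar>I n ps - G ps\<bar>
          \<le> (\<Sum>k=2..n-1. \<epsilon> k) + 63 * e * (1 + (\<Sum>k=2..n-1. (\<Sum>i<k. ps ! i) powr \<alpha>))"
      proof (rule recursive_approximation[OF approx_recursive _ _ n ps])
        fix n p1 p2 qs assume n3: "(n::nat) \<ge> 3" and S: "p1 # p2 # qs \<in> open_simplex n"
        have p: "p1 > 0" "p2 > 0" using S by (auto simp: open_simplex_def)
        \<comment> \<open>A third entry forces \<open>p1 + p2 < 1\<close>, so the equation for
          \<open>l\<close> on the open unit interval applies to \<open>p1 + p2\<close>.\<close>
        obtain q rs where "qs = q # rs" using S n3 by (cases qs) (auto simp: open_simplex_def)
        moreover have "sum_list rs \<ge> 0" if "qs = q # rs"
          using S that by (intro sum_list_nonneg) (auto simp: open_simplex_def less_imp_le)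
        ultimately have "p1 + p2 \<in> {0<..<1}" using S p by (auto simp: open_simplex_def)
        moreover have "p1 / (p1 + p2) \<in> {0<..<1}" using p by auto
        ultimately have "l ((p1 + p2) * (p1 / (p1 + p2))) = l (p1 + p2) + l (p1 / (p1 + p2))"
          using l unfolding logarithmic_def by blast
        then show "G (p1 # p2 # qs) = G ((p1 + p2) # qs)
            + (p1 + p2) powr \<alpha> * G [p1 / (p1 + p2), p2 / (p1 + p2)]"
          using p unfolding G_def entropy_deg_recursive[OF p] nth_Cons_0 \<alpha> by (simp add: distrib_left)
      next
        fix p1 p2 :: real assume S: "[p1, p2] \<in> open_simplex 2"
        then have p: "p1 > 0" "p2 > 0" "p1 + p2 = 1" by (auto simp: open_simplex_def)
        have "G [p1, p2] = a + l p1" using p by (simp add: G_def entropy_deg_def)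
        then show "\<bar>I 2 [p1, p2] - G [p1, p2]\<bar> \<le> 63 * e"
          using al[OF p(1,2)] F_I[OF S] p(3) e0 by simp
      qed
      \<comment> \<open>Positivity matters because \<open>0 powr 0\<close> is 0; for positive
        partial sums every weight is 1, and they add up to \<open>n - 1\<close>.\<close>
      moreover have "(\<Sum>i<k. ps ! i) > 0" if "k \<in> {2..n-1}" for k
        using that ps by (intro sum_pos) (auto simp: open_simplex_def lessThan_empty_iff)
      then have "(\<Sum>k=2..n-1. (\<Sum>i<k. ps ! i) powr \<alpha>) = (\<Sum>k=2..n-1. 1)"
        by (intro sum.cong) (auto simp: \<alpha> less_imp_neq[symmetric])
      then have "1 + (\<Sum>k=2..n-1. (\<Sum>i<k. ps ! i) powr \<alpha>) = real (n - 1)"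
        using n by (simp add: of_nat_diff)
      ultimately show ?thesis by (simp only: mult_ac)
    qed
    show "\<exists>(l :: real \<Rightarrow> real) (c :: real). logarithmic l \<and>
               (\<forall>n\<ge>2. \<forall>ps\<in>open_simplex n.
                  \<bar>I n ps - (c * entropy_deg 0 ps + l (ps ! 0))\<bar>
                    \<le> (\<Sum>k=2..n-1. \<epsilon> k)
                       + 63 * real (n - 1) * (2 * \<epsilon> 2 + \<epsilon> 1))"
      by (intro exI[of _ l] exI[of _ a] conjI l allI impI ballI bound[unfolded G_def e_def])
  qed
qed

end
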